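(* Let $(X_1,Y_1),\dots,(X_n,Y_n)\in\mathbf{R}^d\times\mathbf{R}$, let $\Theta=\mathbf{R}^d$ and $f_\theta(x)=\langle\theta,x\rangle$ for $\theta,x\in\mathbf{R}^d$. Let $\gamma,\beta>0$ and $\lambda=\gamma/\beta$. Under the prior $\pi=\mathcal{N}(0,\gamma^{-1}I_d)$ and with inverse temperature $\beta/2$, the $Q$-aggregation posterior is $\mathcal{N}\big(\widehat\theta_\lambda,\beta^{-1}(\tfrac12\widehat\Sigma_n+\lambda I_d)^{-1}\big)$, while the exponential weights posterior is $\mathcal{N}\big(\widehat\theta_\lambda,\beta^{-1}(\widehat\Sigma_n+\lambda I_d)^{-1}\big)$. The associated prediction functions (the averages $x\mapsto\int f_\theta(x)\,\rho(\mathrm{d}\theta)$ with $\rho$ the respective posterior) both coincide with that of the ridge regression estimator, $f_{\widehat\theta_\lambda}$.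
   Context: $\widehat\Sigma_n=\frac1n\sum_{i=1}^nX_iX_i^{\mathsf T}$. $R_n(f)=\frac1n\sum_{i=1}^n(f(X_i)-Y_i)^2$ is the empirical risk. The ridge estimator is $\widehat\theta_\lambda=\arg\min_{\theta\in\mathbf{R}^d}\{R_n(f_\theta)+\lambda\|\theta\|^2\}=(\widehat\Sigma_n+\lambda I_d)^{-1}\cdot\frac1n\sum_{i=1}^nY_iX_i$. $\mathcal{P}(\Theta)$ is the set of probability measures on $\Theta$. For $\rho\in\mathcal{P}(\Theta)$: $f_\rho(x)=\int_\Theta f_\theta(x)\rho(\mathrm{d}\theta)$, $R_n(\rho)=R_n(f_\rho)$, $\langle\rho,R_n\rangle=\int_\Theta R_n(f_\theta)\rho(\mathrm{d}\theta)$, and $\mathrm{KL}(\rho,\pi)=\int\log\frac{\mathrm{d}\rho}{\mathrm{d}\pi}\,\mathrm{d}\rho$ ($+\infty$ if $\rho\not\ll\pi$). With prior $\pi$ and inverse temperature $\eta>0$, the exponential weights posterior is $\arg\min_{\rho\in\mathcal{P}(\Theta)}\{\langle\rho,R_n\rangle+\frac1\eta\mathrm{KL}(\rho,\pi)\}$ and the $Q$-aggregation posterior is $\arg\min_{\rho\in\mathcal{P}(\Theta)}\{\frac12\langle\rho,R_n\rangle+\frac12R_n(\rho)+\frac1\eta\mathrm{KL}(\rho,\pi)\}$ (the objectives are $+\infty$ when $\langle\rho,R_n\rangle=+\infty$). *)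

theory Defs
  imports "HOL-Probability.Probability"
begin

definition emp_risk :: "nat \<Rightarrow> (nat \<Rightarrow> 'x) \<Rightarrow> (nat \<Rightarrow> real) \<Rightarrow> ('x \<Rightarrow> real) \<Rightarrow> real" where
  "emp_risk n X Y f = (1 / real n) * (\<Sum>i = 1..n. (f (X i) - Y i)\<^sup>2)"

text \<open>The parameter space $\Theta$ is the whole type \<open>'p\<close> with its Borel sets.\<close>

abbreviation prob_measures :: "'p::topological_space measure set" where
  "prob_measures \<equiv> space (prob_algebra borel)"

definition avg_predictor :: "('p \<Rightarrow> 'x \<Rightarrow> real) \<Rightarrow> 'p measure \<Rightarrow> 'x \<Rightarrow> real" where
  "avg_predictor f \<rho> x = (\<integral>\<theta>. f \<theta> x \<partial>\<rho>)"

text \<open>The average $\langle\rho, R_n\rangle$ of the nonnegative risk, possibly infinite. When it is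
  finite, every $f_\theta(X_i)$ is $\rho$-integrable, so the risk of \<open>avg_predictor f \<rho>\<close> is
  meaningful; when it is infinite, so are both objectives below.\<close>

definition avg_risk :: "('p \<Rightarrow> 'x \<Rightarrow> real) \<Rightarrow> nat \<Rightarrow> (nat \<Rightarrow> 'x) \<Rightarrow> (nat \<Rightarrow> real) \<Rightarrow> 'p measure \<Rightarrow> ereal"
  where "avg_risk f n X Y \<rho> = enn2ereal (\<integral>\<^sup>+\<theta>. ennreal (emp_risk n X Y (f \<theta>)) \<partial>\<rho>)"

text \<open>\<^const>\<open>KL_divergence\<close> is real-valued. For probability measures, the negative part of
  $\log (d\rho/d\pi)$ is always $\rho$-integrable, so a non-integrable log-density means that
  the divergence is $+\infty$.\<close>

definition KL :: "'a measure \<Rightarrow> 'a measure \<Rightarrow> ereal" where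
  "KL \<rho> \<pi> =
    (if absolutely_continuous \<pi> \<rho> \<and> integrable \<rho> (entropy_density (exp 1) \<pi> \<rho>)
     then ereal (KL_divergence (exp 1) \<pi> \<rho>) else \<infinity>)"

definition exp_weights_posteriors ::
  "('p::topological_space \<Rightarrow> 'x \<Rightarrow> real) \<Rightarrow> nat \<Rightarrow> (nat \<Rightarrow> 'x) \<Rightarrow> (nat \<Rightarrow> real) \<Rightarrow>
    'p measure \<Rightarrow> real \<Rightarrow> 'p measure set" where
  "exp_weights_posteriors f n X Y \<pi> \<eta> =
    {\<rho>. is_arg_min (\<lambda>\<rho>. avg_risk f n X Y \<rho> + ereal (1 / \<eta>) * KL \<rho> \<pi>) (\<lambda>\<rho>. \<rho> \<in> prob_measures) \<rho>}"

definition Q_aggregation_posteriors ::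
  "('p::topological_space \<Rightarrow> 'x \<Rightarrow> real) \<Rightarrow> nat \<Rightarrow> (nat \<Rightarrow> 'x) \<Rightarrow> (nat \<Rightarrow> real) \<Rightarrow>
    'p measure \<Rightarrow> real \<Rightarrow> 'p measure set" where
  "Q_aggregation_posteriors f n X Y \<pi> \<eta> =
    {\<rho>. is_arg_min
          (\<lambda>\<rho>. ereal (1 / 2) * avg_risk f n X Y \<rho>
             + ereal (1 / 2) * ereal (emp_risk n X Y (avg_predictor f \<rho>))
             + ereal (1 / \<eta>) * KL \<rho> \<pi>)
          (\<lambda>\<rho>. \<rho> \<in> prob_measures) \<rho>}"

definition linear_pred :: "real ^ 'd \<Rightarrow> real ^ 'd \<Rightarrow> real" where
  "linear_pred \<theta> x = \<theta> \<bullet> x"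

definition emp_cov :: "nat \<Rightarrow> (nat \<Rightarrow> real ^ 'd) \<Rightarrow> real ^ 'd ^ 'd" where
  "emp_cov n X = (1 / real n) *\<^sub>R (\<Sum>i = 1..n. \<chi> j k. X i $ j * X i $ k)"

definition ridge_estimator :: "nat \<Rightarrow> (nat \<Rightarrow> real ^ 'd) \<Rightarrow> (nat \<Rightarrow> real) \<Rightarrow> real \<Rightarrow> real ^ 'd" where
  "ridge_estimator n X Y l = (ARG_MIN (\<lambda>\<theta>. emp_risk n X Y (linear_pred \<theta>) + l * (norm \<theta>)\<^sup>2) \<theta>. True)"

text \<open>The Gaussian law with mean \<open>m\<close> and covariance matrix \<open>S\<close>, for symmetric positive
  definite \<open>S\<close> only.\<close>

definition gaussian :: "real ^ 'd \<Rightarrow> real ^ 'd ^ 'd \<Rightarrow> (real ^ 'd) measure" where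
  "gaussian m S = density lborel (\<lambda>x. ennreal
     (exp (- ((x - m) \<bullet> (matrix_inv S *v (x - m))) / 2) / sqrt ((2 * pi) ^ CARD('d) * det S)))"

end

theory Submission
  imports Defs
begin

text \<open>
  Both objectives are instances of
  \[J_a(\rho) = (1-a)\langle\rho,R_n\rangle + a R_n(f_\rho) + \frac2\beta\mathrm{KL}(\rho,\pi),
    \qquad 0\le a<1,\]
  with \<open>a = 1/2\<close> for $Q$-aggregation and \<open>a = 0\<close> for exponential weights. Write \<open>t\<close> for the ridge
  estimator. Only the middle term is not linear in $\rho$ (apart from the divergence), and it is
  convex: it is bounded below by $\langle\rho,L\rangle$, where \<open>L\<close> is the affine function of
  $\theta$ obtained by linearising the squares in $R_n(f_\theta)$ at \<open>t\<close>
  (\<open>integral_linearised_risk\<close>), with equality as soon as $f_\rho = f_t$ at the data points. Hence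
  \[J_a(\rho) \ge \langle\rho,V\rangle + \frac2\beta\mathrm{KL}(\rho,\pi),\qquad
    V = (1-a)R_n + aL.\]
  The right-hand side is a Gibbs objective: it equals a constant plus $\frac2\beta$ times the
  divergence of $\rho$ from the measure \<open>G\<close> with density proportional to $e^{-\beta V/2}$ with
  respect to $\pi$, so \<open>G\<close> is its unique minimiser (\<open>Gibbs_variational_principle\<close>).

  The normal equation for \<open>t\<close> (\<open>ridge_normal_equation\<close>) makes the linear terms of
  $V(\theta)+\lambda\|\theta\|^2$ at \<open>t\<close> cancel, so this function is a constant plus
  $\langle\theta-t,((1-a)\widehat\Sigma_n+\lambda I)(\theta-t)\rangle$
  (\<open>linearised_risk_ridge\<close>). Therefore \<open>G\<close> is the Gaussian with mean \<open>t\<close> and precision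
  $\beta((1-a)\widehat\Sigma_n+\lambda I)$. Its mean predictor is $f_t$, so the linearisation bound
  is an equality at \<open>G\<close>, and \<open>G\<close> is the unique minimiser of $J_a$ as well.

  What remains is to know that the Gaussian density integrates to one, and its first two moments.
  The normalising constant is computed by completing squares one coordinate at a time
  (\<open>pos_def_diagonalise\<close>), the mean by reflection symmetry.
\<close>

section \<open>Positive definite matrices\<close>

text \<open>Symmetry is part of positive definiteness here.\<close>
definition pos_def :: "real ^ 'n ^ 'n \<Rightarrow> bool" where
  "pos_def B \<longleftrightarrow> transpose B = B \<and> (\<forall>x. x \<noteq> 0 \<longrightarrow> 0 < x \<bullet> (B *v x))"

lemma pos_def_scaleR: "pos_def A \<Longrightarrow> 0 < c \<Longrightarrow> pos_def (c *\<^sub>R A)"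
  by (auto simp: pos_def_def transpose_scalar scaleR_matrix_vector_assoc[symmetric])

lemma matrix_entry_inner:
  fixes B :: "real ^ 'n ^ 'n"
  shows "B $ i $ j = axis i 1 \<bullet> (B *v axis j 1)"
  by (simp add: inner_axis' matrix_vector_mul_component inner_axis)

lemma inner_congruence:
  fixes B P :: "real ^ 'n ^ 'n"
  shows "x \<bullet> ((transpose P ** B ** P) *v y) = (P *v x) \<bullet> (B *v (P *v y))"
  by (metis dot_lmul_matrix matrix_vector_mul_assoc vector_transpose_matrix)

lemma pos_def_congruence:
  fixes B P :: "real ^ 'n ^ 'n"
  assumes "pos_def B" "det P \<noteq> 0"
  shows "pos_def (transpose P ** B ** P)"
proof -
  have "P *v x \<noteq> 0" if "x \<noteq> 0" for x
    using assms(2) that by (metis invertible_det_nz invertible_left_inverse matrix_left_invertible_ker)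
  then show ?thesis
    using assms(1) unfolding pos_def_def inner_congruence
    by (simp add: matrix_transpose_mul matrix_mul_assoc)
qed

text \<open>The constant is the minimum of the quadratic form on the unit sphere.\<close>
lemma pos_def_coercive:
  fixes B :: "real ^ 'n ^ 'n"
  assumes "pos_def B"
  obtains c where "c > 0" "\<And>x. c * (norm x)\<^sup>2 \<le> x \<bullet> (B *v x)"
proof -
  have "\<exists>x\<in>sphere 0 1. \<forall>y\<in>sphere 0 1. x \<bullet> (B *v x) \<le> y \<bullet> (B *v y)"
    by (rule continuous_attains_inf)
      (auto intro!: continuous_intros matrix_vector_mult_linear_continuous_on)
  then obtain u where u: "norm u = 1" "\<And>y. norm y = 1 \<Longrightarrow> u \<bullet> (B *v u) \<le> y \<bullet> (B *v y)"
    by auto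
  show ?thesis
  proof (rule that)
    show "u \<bullet> (B *v u) > 0" using assms u(1) unfolding pos_def_def by (metis norm_zero zero_neq_one)
    fix x
    show "u \<bullet> (B *v u) * (norm x)\<^sup>2 \<le> x \<bullet> (B *v x)"
    proof (cases "x = 0")
      case False
      then show ?thesis
        using u(2)[of "(1 / norm x) *\<^sub>R x"]
        by (simp add: matrix_vector_mult_scaleR field_simps power2_eq_square)
    qed simp
  qed
qed

lemma matrix_inv_unique:
  fixes A B :: "real ^ 'n ^ 'n"
  assumes "A ** B = mat 1"
  shows "matrix_inv A = B"
  unfolding matrix_inv_def
proof (rule some_equality)
  show BA: "A ** B = mat 1 \<and> B ** A = mat 1"
    using assms by (simp add: matrix_left_right_inverse)
  fix C assume "A ** C = mat 1 \<and> C ** A = mat 1"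
  then have "C = C ** (A ** B)" using assms by simp
  also have "\<dots> = B" using \<open>A ** C = mat 1 \<and> C ** A = mat 1\<close> by (simp add: matrix_mul_assoc)
  finally show "C = B" .
qed

lemma matrix_inv_invertible:
  fixes A :: "real ^ 'n ^ 'n"
  assumes "invertible A"
  shows "A ** matrix_inv A = mat 1" "matrix_inv A ** A = mat 1"
  using assms matrix_inv_unique[of A] by (auto simp: invertible_def)

lemma scaled_matrix_inv:
  fixes A :: "real ^ 'n ^ 'n"
  assumes "invertible A" "c \<noteq> 0"
  shows "(1 / c) *\<^sub>R matrix_inv A = matrix_inv (c *\<^sub>R A)"
proof -
  have "(c *\<^sub>R A) ** ((1 / c) *\<^sub>R matrix_inv A) = mat 1"
    using assms by (simp add: matrix_scalar_ac scalar_matrix_assoc[symmetric] matrix_inv_invertible)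
  then show ?thesis by (rule matrix_inv_unique[symmetric])
qed

section \<open>The Gaussian integral\<close>

text \<open>Tonelli's theorem, with the coordinate along the basis vector \<open>b\<close> integrated first.\<close>
lemma nn_integral_lborel_split_coordinate:
  fixes h :: "'a::euclidean_space \<Rightarrow> ennreal"
  assumes [measurable]: "h \<in> borel_measurable borel" and b: "b \<in> Basis"
  shows "(\<integral>\<^sup>+x. h x \<partial>lborel) =
    (\<integral>\<^sup>+f. (\<integral>\<^sup>+t. h ((\<Sum>c\<in>Basis - {b}. f c *\<^sub>R c) + t *\<^sub>R b) \<partial>lborel) \<partial>PiM (Basis - {b}) (\<lambda>_. lborel))"
proof -
  interpret product_sigma_finite "\<lambda>_::'a. lborel :: real measure" ..
  have [measurable]: "(\<lambda>f. h (\<Sum>c\<in>Basis. f c *\<^sub>R c)) \<in> borel_measurable (PiM Basis (\<lambda>_. lborel))"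
    by measurable
  have "(\<integral>\<^sup>+x. h x \<partial>lborel) = (\<integral>\<^sup>+f. h (\<Sum>c\<in>Basis. f c *\<^sub>R c) \<partial>PiM Basis (\<lambda>_. lborel))"
    by (subst lborel_eq) (simp add: nn_integral_distr)
  also have "\<dots> = (\<integral>\<^sup>+f. h (\<Sum>c\<in>Basis. f c *\<^sub>R c) \<partial>PiM (insert b (Basis - {b})) (\<lambda>_. lborel))"
    using b by (simp add: insert_absorb)
  also have "\<dots> = (\<integral>\<^sup>+f. (\<integral>\<^sup>+t. h (\<Sum>c\<in>Basis. (f(b := t)) c *\<^sub>R c) \<partial>lborel) \<partial>PiM (Basis - {b}) (\<lambda>_. lborel))"
    using b by (intro product_nn_integral_insert) (auto simp: insert_absorb)
  also have "\<dots> = (\<integral>\<^sup>+f. (\<integral>\<^sup>+t. h ((\<Sum>c\<in>Basis - {b}. f c *\<^sub>R c) + t *\<^sub>R b) \<partial>lborel) \<partial>PiM (Basis - {b}) (\<lambda>_. lborel))"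
    using b by (intro nn_integral_cong arg_cong[where f = h]) (simp add: sum.remove[of _ b] add.commute)
  finally show ?thesis .
qed

text \<open>A shear along \<open>b\<close> translates the coordinate along \<open>b\<close> by an amount that depends on the
  other coordinates only, so it preserves Lebesgue measure.\<close>
lemma nn_integral_lborel_shear:
  fixes g :: "'a::euclidean_space \<Rightarrow> ennreal"
  assumes [measurable]: "g \<in> borel_measurable borel" "\<psi> \<in> borel_measurable borel"
    and b: "b \<in> Basis" and \<psi>: "\<And>x t. \<psi> (x + t *\<^sub>R b) = \<psi> x"
  shows "(\<integral>\<^sup>+x. g (x + \<psi> x *\<^sub>R b) \<partial>lborel) = (\<integral>\<^sup>+x. g x \<partial>lborel)"
proof -
  have "(\<integral>\<^sup>+t. g (y + t *\<^sub>R b + \<psi> (y + t *\<^sub>R b) *\<^sub>R b) \<partial>lborel) = (\<integral>\<^sup>+t. g (y + t *\<^sub>R b) \<partial>lborel)" for y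
    by (subst nn_integral_real_affine[where c = 1 and t = "\<psi> y" and f = "\<lambda>t. g (y + t *\<^sub>R b)"])
       (auto simp: \<psi> scaleR_add_left algebra_simps)
  then show ?thesis
    using b by (simp add: nn_integral_lborel_split_coordinate[of _ b])
qed

text \<open>Completing the square in one coordinate after the other brings a positive definite
  quadratic form to diagonal form by a product of shears. Such a product has determinant one and
  preserves Lebesgue measure, which makes the general change of variables formula for linear maps
  unnecessary. The set \<open>S\<close> collects the coordinates already separated from the others.\<close>
lemma pos_def_diagonalise:
  fixes B :: "real ^ 'n ^ 'n"
  assumes "pos_def B"
  shows "\<exists>P. det P = 1
    \<and> (\<forall>g \<in> borel_measurable borel. (\<integral>\<^sup>+x. g (P *v x) \<partial>lborel) = (\<integral>\<^sup>+x. (g x :: ennreal) \<partial>lborel))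
    \<and> (\<forall>i\<in>S. \<forall>j. i \<noteq> j \<longrightarrow> (transpose P ** B ** P) $ i $ j = 0)"
proof -
  have "finite S" by simp
  then show ?thesis
  proof (induction S rule: finite_induct)
    case empty
    show ?case by (rule exI[of _ "mat 1"]) simp
  next
    case (insert b S)
    from insert.IH obtain P where P: "det P = 1"
      "\<forall>g \<in> borel_measurable borel. (\<integral>\<^sup>+x. g (P *v x) \<partial>lborel) = (\<integral>\<^sup>+x. (g x :: ennreal) \<partial>lborel)"
      "\<forall>i\<in>S. \<forall>j. i \<noteq> j \<longrightarrow> (transpose P ** B ** P) $ i $ j = 0"
      by (elim exE conjE) (rule that)
    define C where "C = transpose P ** B ** P"
    have C: "pos_def C" unfolding C_def using assms P(1) by (intro pos_def_congruence) auto
    then have sym: "C $ i $ j = C $ j $ i" for i j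
      by (subst (2) C[unfolded pos_def_def, THEN conjunct1, symmetric]) (simp add: transpose_def)
    have pos: "C $ b $ b > 0"
      using C unfolding pos_def_def matrix_entry_inner[of C] by (simp add: axis_eq_0_iff)
    \<comment> \<open>The matrix \<open>E\<close> of the shear that adds \<open>v \<bullet> x\<close> to the coordinate \<open>b\<close> of \<open>x\<close>. The choice of
      \<open>v\<close> cancels the entries of row \<open>b\<close> of \<open>C\<close> off the diagonal.\<close>
    define \<psi> where "\<psi> j = (if j = b then 0 else - C $ b $ j / C $ b $ b)" for j
    define v where "v = (\<chi> j. \<psi> j)"
    define E :: "real ^ 'n ^ 'n" where "E = (\<chi> k. if k = b then row b (mat 1) + v else row k (mat 1))"
    have row1: "row k (mat 1 :: real ^ 'n ^ 'n) = axis k 1" for k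
      by (auto simp: vec_eq_iff row_def mat_def axis_def)
    have Ex: "E *v x = x + (v \<bullet> x) *\<^sub>R axis b 1" for x
      by (auto simp: vec_eq_iff matrix_vector_mul_component E_def row1 inner_add_left inner_axis')
        (simp_all add: axis_def)
    have Ea: "E *v axis j 1 = axis j 1 + \<psi> j *\<^sub>R axis b 1" for j
      by (simp add: Ex inner_axis v_def)
    have "v = (\<Sum>j\<in>UNIV - {b}. \<psi> j *\<^sub>R row j (mat 1))"
      by (auto simp: vec_eq_iff v_def row_def mat_def \<psi>_def if_distrib cong: if_cong)
    also have "\<dots> \<in> vec.span {row j (mat 1) |j. j \<noteq> b}"
      unfolding scalar_mult_eq_scaleR[symmetric]
      by (intro vec.span_sum vec.span_scale vec.span_base) auto
    finally have "det E = det (mat 1 :: real ^ 'n ^ 'n)"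
      unfolding E_def by (rule det_row_span)
    then have detE: "det E = 1" by simp
    have intE: "(\<integral>\<^sup>+x. g (E *v x) \<partial>lborel) = (\<integral>\<^sup>+x. g x \<partial>lborel)"
      if "g \<in> borel_measurable borel" for g :: "real ^ 'n \<Rightarrow> ennreal"
      unfolding Ex using that
      by (rule nn_integral_lborel_shear) (auto simp: inner_add_right inner_axis v_def \<psi>_def axis_in_Basis_iff)
    have entry: "(transpose E ** C ** E) $ i $ j
        = C $ i $ j + \<psi> j * C $ i $ b + \<psi> i * (C $ b $ j + \<psi> j * C $ b $ b)" for i j
      unfolding matrix_entry_inner[of "transpose E ** C ** E"] inner_congruence Ea
      unfolding matrix_entry_inner[of C]
      by (simp add: matrix_vector_right_distrib matrix_vector_mult_scaleR inner_add_left inner_add_right algebra_simps)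
    have zero: "(transpose E ** C ** E) $ i $ j = 0" if "i \<in> insert b S" "i \<noteq> j" for i j
    proof (cases "i = b")
      case True
      then show ?thesis using that pos by (simp add: entry \<psi>_def)
    next
      case False
      then have "i \<in> S" using that by simp
      then have "C $ i $ j = 0" "C $ i $ b = 0" using P(3) that False unfolding C_def by auto
      moreover then have "\<psi> i = 0" using sym[of i b] by (simp add: \<psi>_def)
      ultimately show ?thesis by (simp add: entry)
    qed
    have "transpose (P ** E) ** B ** (P ** E) = transpose E ** C ** E"
      by (simp add: C_def matrix_transpose_mul matrix_mul_assoc)
    moreover have "(\<integral>\<^sup>+x. g ((P ** E) *v x) \<partial>lborel) = (\<integral>\<^sup>+x. g x \<partial>lborel)"
      if [measurable]: "g \<in> borel_measurable borel" for g :: "real ^ 'n \<Rightarrow> ennreal"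
    proof -
      have [measurable]: "(*v) P \<in> borel_measurable borel"
        by (rule borel_measurable_continuous_onI[OF matrix_vector_mult_linear_continuous_on])
      have "(\<integral>\<^sup>+x. g (P *v (E *v x)) \<partial>lborel) = (\<integral>\<^sup>+x. g (P *v x) \<partial>lborel)"
        by (rule intE) measurable
      with P(2) that show ?thesis by (simp add: matrix_vector_mul_assoc)
    qed
    ultimately show ?case
      using zero P(1) detE by (intro exI[of _ "P ** E"]) (auto simp: det_mul)
  qed
qed

lemma nn_integral_exp_square:
  fixes c :: real
  assumes "c > 0"
  shows "(\<integral>\<^sup>+t. ennreal (exp (- (c * t\<^sup>2) / 2)) \<partial>lborel) = ennreal (sqrt (2 * pi / c))"
proof -
  let ?s = "1 / sqrt c"
  have "1 = (\<integral>\<^sup>+t. ennreal (normal_density 0 ?s t) \<partial>lborel)"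
    using prob_space.emeasure_space_1[OF prob_space_normal_density[of ?s 0]] assms
    by (simp add: emeasure_density)
  also have "\<dots> = (\<integral>\<^sup>+t. ennreal (1 / sqrt (2 * pi / c)) * ennreal (exp (- (c * t\<^sup>2) / 2)) \<partial>lborel)"
    using assms by (intro nn_integral_cong) (simp add: normal_density_def power_divide ennreal_mult'[symmetric] field_simps)
  also have "\<dots> = ennreal (1 / sqrt (2 * pi / c)) * (\<integral>\<^sup>+t. ennreal (exp (- (c * t\<^sup>2) / 2)) \<partial>lborel)"
    by (rule nn_integral_cmult) simp
  finally have "ennreal (sqrt (2 * pi / c)) * 1 = ennreal (sqrt (2 * pi / c)) * (ennreal (1 / sqrt (2 * pi / c)) * (\<integral>\<^sup>+t. ennreal (exp (- (c * t\<^sup>2) / 2)) \<partial>lborel))"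
    by simp
  then show ?thesis
    using assms by (simp add: mult.assoc[symmetric] ennreal_mult'[symmetric])
qed

lemma prod_Basis_cart:
  fixes F :: "real ^ 'n \<Rightarrow> 'b::comm_monoid_mult"
  shows "(\<Prod>b\<in>Basis. F b) = (\<Prod>i\<in>UNIV. F (axis i 1))"
proof -
  have Basis: "(Basis :: (real ^ 'n) set) = range (\<lambda>i. axis i 1)"
    by (auto simp: Basis_vec_def)
  have "inj (\<lambda>i::'n. axis i (1::real))"
    by (auto simp: inj_def axis_eq_axis)
  then show ?thesis unfolding Basis by (subst prod.reindex) simp_all
qed

lemma sqrt_prod: "sqrt (\<Prod>i\<in>A. f i) = (\<Prod>i\<in>A. sqrt (f i))"
  by (induction A rule: infinite_finite_induct) (simp_all add: real_sqrt_mult)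

lemma nn_integral_gaussian_kernel:
  fixes B :: "real ^ 'n ^ 'n"
  assumes "pos_def B"
  shows "det B > 0"
    and "(\<integral>\<^sup>+x. ennreal (exp (- (x \<bullet> (B *v x)) / 2)) \<partial>lborel) = ennreal (sqrt ((2 * pi) ^ CARD('n) / det B))"
proof -
  from pos_def_diagonalise[OF assms, of UNIV] obtain P where P: "det P = 1"
      "\<forall>g \<in> borel_measurable borel. (\<integral>\<^sup>+x. g (P *v x) \<partial>lborel) = (\<integral>\<^sup>+x. (g x :: ennreal) \<partial>lborel)"
      "\<forall>i\<in>UNIV. \<forall>j. i \<noteq> j \<longrightarrow> (transpose P ** B ** P) $ i $ j = 0"
    by (elim exE conjE) (rule that)
  define D where "D = transpose P ** B ** P"
  have D0: "D $ i $ j = 0" if "i \<noteq> j" for i j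
    using P(3) that by (simp add: D_def)
  have "pos_def D"
    unfolding D_def using assms P(1) by (intro pos_def_congruence) auto
  then have Dpos: "D $ i $ i > 0" for i
    unfolding pos_def_def matrix_entry_inner[of D] by simp
  have "det D = det B"
    using P(1) by (simp add: D_def det_mul)
  moreover have detD: "det D = (\<Prod>i\<in>UNIV. D $ i $ i)"
    by (rule det_diagonal) (rule D0)
  ultimately have detB: "det B = (\<Prod>i\<in>UNIV. D $ i $ i)" by simp
  show "det B > 0"
    unfolding detB using Dpos by (simp add: prod_pos)
  have Dx: "(D *v x) $ i = D $ i $ i * x $ i" for x i
  proof -
    have "(D *v x) $ i = (\<Sum>j\<in>UNIV. D $ i $ j * x $ j)"
      by (simp add: matrix_vector_mult_def)
    also have "\<dots> = (\<Sum>j\<in>UNIV. if j = i then D $ i $ i * x $ i else 0)"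
      by (rule sum.cong) (use D0 in auto)
    finally have "(D *v x) $ i = (\<Sum>j\<in>UNIV. if j = i then D $ i $ i * x $ i else 0)" .
    then show ?thesis by simp
  qed
  have [measurable]: "(\<lambda>x. ennreal (exp (- (x \<bullet> (B *v x)) / 2))) \<in> borel_measurable borel"
    by (intro measurable_compose[OF _ measurable_ennreal] borel_measurable_continuous_onI
        continuous_intros matrix_vector_mult_linear_continuous_on) simp
  have "(\<integral>\<^sup>+x. ennreal (exp (- (x \<bullet> (B *v x)) / 2)) \<partial>lborel)
      = (\<integral>\<^sup>+x. ennreal (exp (- ((P *v x) \<bullet> (B *v (P *v x))) / 2)) \<partial>lborel)"
    by (rule P(2)[rule_format, symmetric]) measurable
  also have "\<dots> = (\<integral>\<^sup>+x. (\<Prod>b\<in>Basis. ennreal (exp (- ((b \<bullet> (D *v b)) * (x \<bullet> b)\<^sup>2) / 2))) \<partial>lborel)"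
  proof (rule nn_integral_cong)
    fix x :: "real ^ 'n"
    have "(\<Prod>b\<in>Basis. ennreal (exp (- ((b \<bullet> (D *v b)) * (x \<bullet> b)\<^sup>2) / 2)))
        = (\<Prod>i\<in>UNIV. ennreal (exp (- (D $ i $ i * (x $ i)\<^sup>2) / 2)))"
      unfolding prod_Basis_cart matrix_entry_inner[of D, symmetric] by (simp add: inner_axis)
    also have "\<dots> = ennreal (exp (\<Sum>i\<in>UNIV. - (D $ i $ i * (x $ i)\<^sup>2) / 2))"
      by (simp add: prod_ennreal exp_sum)
    also have "(\<Sum>i\<in>UNIV. - (D $ i $ i * (x $ i)\<^sup>2) / 2) = - (x \<bullet> (D *v x)) / 2"
      by (simp add: inner_vec_def Dx sum_negf sum_divide_distrib power2_eq_square mult_ac)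
    finally show "ennreal (exp (- ((P *v x) \<bullet> (B *v (P *v x))) / 2))
        = (\<Prod>b\<in>Basis. ennreal (exp (- ((b \<bullet> (D *v b)) * (x \<bullet> b)\<^sup>2) / 2)))"
      by (simp add: D_def inner_congruence)
  qed
  also have "\<dots> = (\<Prod>b\<in>Basis. \<integral>\<^sup>+t. ennreal (exp (- ((b \<bullet> (D *v b)) * t\<^sup>2) / 2)) \<partial>lborel)"
    by (rule nn_integral_lborel_prod) auto
  also have "\<dots> = (\<Prod>i\<in>UNIV. ennreal (sqrt (2 * pi / D $ i $ i)))"
    unfolding prod_Basis_cart matrix_entry_inner[of D, symmetric]
    by (simp only: nn_integral_exp_square[OF Dpos])
  also have "\<dots> = ennreal (\<Prod>i\<in>UNIV. sqrt (2 * pi / D $ i $ i))"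
    using Dpos by (intro prod_ennreal) (simp add: less_imp_le)
  also have "(\<Prod>i\<in>UNIV. sqrt (2 * pi / D $ i $ i)) = sqrt (\<Prod>i\<in>UNIV. 2 * pi / D $ i $ i)"
    by (simp add: sqrt_prod)
  also have "(\<Prod>i\<in>UNIV. 2 * pi / D $ i $ i) = (2 * pi) ^ CARD('n) / det B"
    by (simp add: detB prod_dividef)
  finally show "(\<integral>\<^sup>+x. ennreal (exp (- (x \<bullet> (B *v x)) / 2)) \<partial>lborel)
      = ennreal (sqrt ((2 * pi) ^ CARD('n) / det B))" .
qed

lemma pos_def_invertible: "pos_def B \<Longrightarrow> invertible B"
  using nn_integral_gaussian_kernel(1)[of B] by (simp add: invertible_det_nz)

section \<open>Gaussian measures\<close>

text \<open>The Gaussian density with mean \<open>m\<close>, parametrised by the precision matrix \<open>B\<close>, that is the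
  inverse of the covariance matrix.\<close>
definition gaussian_density :: "real ^ 'n \<Rightarrow> real ^ 'n ^ 'n \<Rightarrow> real ^ 'n \<Rightarrow> real" where
  "gaussian_density m B x = sqrt (det B / (2 * pi) ^ CARD('n)) * exp (- ((x - m) \<bullet> (B *v (x - m))) / 2)"

lemma gaussian_density_pos: "pos_def B \<Longrightarrow> 0 < gaussian_density m B x"
  by (simp add: gaussian_density_def nn_integral_gaussian_kernel(1))

lemma borel_measurable_quadratic_form[measurable]:
  fixes m :: "real ^ 'n"
  shows "(\<lambda>x. (x - m) \<bullet> (B *v (x - m))) \<in> borel_measurable borel"
  by (intro borel_measurable_continuous_onI continuous_intros
      continuous_on_compose2[OF matrix_vector_mult_linear_continuous_on[of UNIV]]) simp

lemma borel_measurable_gaussian_density[measurable]: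
  "gaussian_density m B \<in> borel_measurable borel"
  unfolding gaussian_density_def[abs_def] by measurable

lemma gaussian_matrix_inv:
  assumes "pos_def B"
  shows "gaussian m (matrix_inv B) = density lborel (\<lambda>x. ennreal (gaussian_density m B x))"
proof -
  have inv: "B ** matrix_inv B = mat 1" "matrix_inv B ** B = mat 1"
    using pos_def_invertible[OF assms] by (simp_all add: matrix_inv_invertible)
  have "det B * det (matrix_inv B) = 1"
    using arg_cong[OF inv(1), of det] by (simp add: det_mul)
  then have "det (matrix_inv B) = 1 / det B"
    using nn_integral_gaussian_kernel(1)[OF assms] by (simp add: field_simps)
  then show ?thesis
    unfolding gaussian_def gaussian_density_def
    by (simp add: matrix_inv_unique[OF inv(2)] real_sqrt_divide mult.commute)
qed

lemma prob_space_gaussian_density: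
  assumes "pos_def B"
  shows "prob_space (density lborel (\<lambda>x. ennreal (gaussian_density m B x)))"
proof (rule prob_spaceI)
  have pos: "det B > 0" by (rule nn_integral_gaussian_kernel(1)[OF assms])
  let ?k = "\<lambda>x. ennreal (exp (- (x \<bullet> (B *v x)) / 2))"
  have [measurable]: "(\<lambda>x. x \<bullet> (B *v x)) \<in> borel_measurable borel"
    using borel_measurable_quadratic_form[of 0 B] by simp
  have "(\<integral>\<^sup>+x. ?k x \<partial>lborel) = (\<integral>\<^sup>+x. ?k x \<partial>distr lborel borel ((+) (- m)))"
    by (simp add: lborel_distr_plus)
  also have "\<dots> = (\<integral>\<^sup>+x. ?k (x - m) \<partial>lborel)"
    by (subst nn_integral_distr) simp_all
  finally have "(\<integral>\<^sup>+x. ennreal (gaussian_density m B x) \<partial>lborel)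
      = ennreal (sqrt (det B / (2 * pi) ^ CARD('a))) * (\<integral>\<^sup>+x. ?k x \<partial>lborel)"
    using pos by (simp add: gaussian_density_def ennreal_mult' nn_integral_cmult)
  also have "\<dots> = 1"
    using pos unfolding nn_integral_gaussian_kernel(2)[OF assms]
    by (simp add: ennreal_mult'[symmetric] real_sqrt_mult[symmetric])
  finally show "emeasure (density lborel (\<lambda>x. ennreal (gaussian_density m B x)))
      (space (density lborel (\<lambda>x. ennreal (gaussian_density m B x)))) = 1"
    by (simp add: emeasure_density)
qed

text \<open>With \<open>q\<close> the quadratic form of \<open>B\<close> at \<open>x - m\<close>, the square of the norm is at most a
  multiple of \<open>q\<close>, and $q e^{-q/2} \le 4 e^{-q/4}$, where the right-hand side is up to a constant the
  density with precision \<open>B/2\<close>.\<close>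
lemma integrable_gaussian_norm_square:
  assumes "pos_def B"
  shows "integrable (density lborel (\<lambda>x. ennreal (gaussian_density m B x))) (\<lambda>x. (norm (x - m))\<^sup>2)"
proof -
  obtain c where c: "c > 0" "\<And>x. c * (norm x)\<^sup>2 \<le> x \<bullet> (B *v x)"
    using pos_def_coercive[OF assms] by blast
  have B2: "pos_def ((1/2) *\<^sub>R B)"
    using assms by (intro pos_def_scaleR) auto
  interpret prob_space "density lborel (\<lambda>x. ennreal (gaussian_density m ((1/2) *\<^sub>R B) x))"
    by (rule prob_space_gaussian_density[OF B2])
  define K where "K = sqrt (det B / (2 * pi) ^ CARD('a))"
  define K2 where "K2 = sqrt (det ((1/2) *\<^sub>R B) / (2 * pi) ^ CARD('a))"
  have K: "K > 0" "K2 > 0"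
    using nn_integral_gaussian_kernel(1)[OF assms] nn_integral_gaussian_kernel(1)[OF B2]
    by (simp_all add: K_def K2_def)
  have "integrable (density lborel (\<lambda>x. ennreal (gaussian_density m ((1/2) *\<^sub>R B) x))) (\<lambda>x. 1::real)"
    by simp
  then have int: "integrable lborel (gaussian_density m ((1/2) *\<^sub>R B))"
    using gaussian_density_pos[OF B2]
    by (subst (asm) integrable_density) (auto simp: less_imp_le)
  have "integrable lborel (\<lambda>x. gaussian_density m B x *\<^sub>R (norm (x - m))\<^sup>2)"
  proof (rule Bochner_Integration.integrable_bound)
    show "integrable lborel (\<lambda>x. 4 * K / (c * K2) * gaussian_density m ((1/2) *\<^sub>R B) x)"
      using int by simp
    show "AE x in lborel. norm (gaussian_density m B x *\<^sub>R (norm (x - m))\<^sup>2)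
        \<le> norm (4 * K / (c * K2) * gaussian_density m ((1/2) *\<^sub>R B) x)"
    proof (rule AE_I2)
      fix x
      define q where "q = (x - m) \<bullet> (B *v (x - m))"
      have q2: "(x - m) \<bullet> (((1/2) *\<^sub>R B) *v (x - m)) = q / 2"
        by (simp add: q_def scaleR_matrix_vector_assoc[symmetric])
      have "(norm (x - m))\<^sup>2 \<le> q / c"
        using c(2)[of "x - m"] c(1) by (simp add: q_def field_simps)
      moreover have "q / 4 \<le> exp (q / 4)"
        using exp_ge_add_one_self[of "q / 4"] by linarith
      ultimately have "(norm (x - m))\<^sup>2 \<le> 4 / c * exp (q / 4)"
        using c(1) by (simp add: field_simps)
      then have "K * exp (- q / 2) * (norm (x - m))\<^sup>2 \<le> K * exp (- q / 2) * (4 / c * exp (q / 4))"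
        using K by (intro mult_left_mono) auto
      also have "\<dots> = 4 * K / (c * K2) * (K2 * exp (- (q / 2) / 2))"
        using K c(1) by (simp add: mult_exp_exp field_simps)
      finally have "gaussian_density m B x * (norm (x - m))\<^sup>2
          \<le> 4 * K / (c * K2) * gaussian_density m ((1/2) *\<^sub>R B) x"
        unfolding gaussian_density_def q2 K_def[symmetric] K2_def[symmetric] q_def[symmetric] .
      moreover have "0 \<le> gaussian_density m B x * (norm (x - m))\<^sup>2"
        using gaussian_density_pos[OF assms, of m x] by simp
      ultimately show "norm (gaussian_density m B x *\<^sub>R (norm (x - m))\<^sup>2)
          \<le> norm (4 * K / (c * K2) * gaussian_density m ((1/2) *\<^sub>R B) x)"
        unfolding real_norm_def real_scaleR_def by linarith
    qed
  qed measurable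
  then show ?thesis
    using gaussian_density_pos[OF assms] by (subst integrable_density) (auto simp: less_imp_le)
qed

text \<open>The mean follows from the invariance of the density under the reflection \<open>2 m - x\<close>.\<close>
lemma gaussian_mean:
  fixes a m :: "real ^ 'n"
  assumes "pos_def B"
  defines "G \<equiv> density lborel (\<lambda>x. ennreal (gaussian_density m B x))"
  shows "integrable G (\<lambda>x. a \<bullet> x)" "(\<integral>x. a \<bullet> x \<partial>G) = a \<bullet> m"
proof -
  interpret G: prob_space G unfolding G_def by (rule prob_space_gaussian_density[OF assms(1)])
  have [measurable_cong]: "sets G = sets borel" by (simp add: G_def)
  have "integrable G (\<lambda>x. a \<bullet> (x - m))"
  proof (rule Bochner_Integration.integrable_bound)
    show "integrable G (\<lambda>x. norm a * (1 + (norm (x - m))\<^sup>2))"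
      using integrable_gaussian_norm_square[OF assms(1), of m] by (simp add: G_def[symmetric])
    have "\<bar>a \<bullet> (x - m)\<bar> \<le> norm a * (1 + (norm (x - m))\<^sup>2)" for x
    proof -
      have "2 * norm (x - m) \<le> 1 + (norm (x - m))\<^sup>2"
        using sum_squares_bound[of 1 "norm (x - m)"] by simp
      then have "norm (x - m) \<le> 1 + (norm (x - m))\<^sup>2"
        using norm_ge_zero[of "x - m"] by linarith
      then have "norm a * norm (x - m) \<le> norm a * (1 + (norm (x - m))\<^sup>2)"
        by (rule mult_left_mono) simp
      with Cauchy_Schwarz_ineq2[of a "x - m"] show ?thesis by linarith
    qed
    then show "AE x in G. norm (a \<bullet> (x - m)) \<le> norm (norm a * (1 + (norm (x - m))\<^sup>2))"
      by (intro AE_I2) (auto simp: abs_mult)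
  qed measurable
  then have "integrable G (\<lambda>x. a \<bullet> (x - m) + a \<bullet> m)" by simp
  then show int: "integrable G (\<lambda>x. a \<bullet> x)" by (simp add: inner_diff_right)
  have refl: "(lborel :: (real ^ 'n) measure) = distr lborel borel (\<lambda>x. 2 *\<^sub>R m - x)"
    using lborel_affine[of "-1" "2 *\<^sub>R m"] by (simp add: density_1)
  have sym: "gaussian_density m B (2 *\<^sub>R m - x) = gaussian_density m B x" for x
  proof -
    have eq: "2 *\<^sub>R m - x - m = - (x - m)" by (simp add: scaleR_2)
    show ?thesis unfolding gaussian_density_def eq
      using matrix_vector_mult_scaleR[of B "-1" "x - m"] by (simp del: minus_diff_eq)
  qed
  have dens: "(\<integral>x. f x \<partial>G) = (\<integral>x. gaussian_density m B x * f x \<partial>lborel)"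
    if "f \<in> borel_measurable borel" for f :: "real ^ 'n \<Rightarrow> real"
    unfolding G_def using that gaussian_density_pos[OF assms(1)]
    by (subst integral_density) (auto simp: less_imp_le)
  have "(\<integral>x. a \<bullet> x \<partial>G) = (\<integral>x. gaussian_density m B x * (a \<bullet> x) \<partial>lborel)"
    by (rule dens) simp
  also have "\<dots> = (\<integral>x. gaussian_density m B x * (a \<bullet> (2 *\<^sub>R m - x)) \<partial>lborel)"
    by (subst refl, subst integral_distr) (simp_all add: sym)
  also have "\<dots> = (\<integral>x. a \<bullet> (2 *\<^sub>R m - x) \<partial>G)"
    by (rule dens[symmetric]) simp
  also have "\<dots> = 2 * (a \<bullet> m) - (\<integral>x. a \<bullet> x \<partial>G)"
    using int by (simp add: inner_diff_right G.prob_space)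
  finally show "(\<integral>x. a \<bullet> x \<partial>G) = a \<bullet> m" by simp
qed

lemma gaussian_predictor:
  assumes "pos_def B"
  shows "integrable (gaussian m (matrix_inv B)) (\<lambda>\<theta>. linear_pred \<theta> x)"
    and "avg_predictor linear_pred (gaussian m (matrix_inv B)) = linear_pred m"
proof -
  have linear_pred: "linear_pred \<theta> x = x \<bullet> \<theta>" for \<theta> x :: "real ^ 'a"
    by (simp add: linear_pred_def inner_commute)
  show "integrable (gaussian m (matrix_inv B)) (\<lambda>\<theta>. linear_pred \<theta> x)"
    "avg_predictor linear_pred (gaussian m (matrix_inv B)) = linear_pred m"
    unfolding avg_predictor_def fun_eq_iff linear_pred gaussian_matrix_inv[OF assms]
    using gaussian_mean[OF assms, where m = m] by simp_all
qed

section \<open>The Gibbs variational principle\<close>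

text \<open>For the probability measure \<open>Q\<close> with density \<open>h\<close> with respect to \<open>P\<close>,
  \[\mathrm{KL}(\rho,P) - \int\ln h\,\mathrm{d}\rho = \mathrm{KL}(\rho,Q) \ge 0,\]
  with equality only for $\rho = Q$. The reference measure is the second argument of $\mathrm{KL}$
  in this formula, but the first one in \<open>KL_divergence (exp 1) P \<rho>\<close>.\<close>
lemma Gibbs_variational_principle:
  fixes h :: "'a \<Rightarrow> real"
  assumes "prob_space P" and [measurable]: "h \<in> borel_measurable P" and h: "\<And>x. 0 < h x"
    and Q: "prob_space (density P h)" and \<rho>: "prob_space \<rho>" "sets \<rho> = sets P"
    and ac: "absolutely_continuous P \<rho>"
    and int: "integrable \<rho> (entropy_density (exp 1) P \<rho>)" "integrable \<rho> (\<lambda>x. ln (h x))"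
  shows "(\<integral>x. ln (h x) \<partial>\<rho>) \<le> KL_divergence (exp 1) P \<rho>"
    and "(\<integral>x. ln (h x) \<partial>\<rho>) = KL_divergence (exp 1) P \<rho> \<Longrightarrow> \<rho> = density P h"
proof -
  interpret P: prob_space P by fact
  interpret Q: prob_space "density P h" by fact
  interpret Q: information_space "density P h" "exp 1" by standard simp
  interpret \<rho>: prob_space \<rho> by fact
  have fin: "finite_measure \<rho>" by unfold_locales
  from P.real_RN_deriv[OF fin ac \<rho>(2)] obtain D
    where D [measurable]: "D \<in> borel_measurable P"
      and RN: "AE x in P. RN_deriv P \<rho> x = ennreal (D x)" and Dpos: "AE x in \<rho>. 0 < D x"
      and D0: "\<And>x. 0 \<le> D x" by blast
  have "\<rho> = density P (RN_deriv P \<rho>)"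
    using ac \<rho>(2) by (rule P.density_RN_deriv[symmetric])
  also have "\<dots> = density P D"
    using RN by (auto intro!: density_cong)
  finally have \<rho>D: "\<rho> = density P D" .
  have \<rho>Dh: "\<rho> = density (density P h) (\<lambda>x. D x / h x)"
    unfolding \<rho>D using h D0 by (intro density_density_divide[symmetric]) (auto simp: less_imp_le less_imp_neq[OF h, symmetric])
  have h\<rho>[measurable]: "h \<in> borel_measurable \<rho>" "D \<in> borel_measurable \<rho>"
    using \<rho>(2) by (simp_all cong: measurable_cong_sets)
  have "AE x in \<rho>. RN_deriv P \<rho> x = ennreal (D x)"
    by (rule absolutely_continuous_AE[OF \<rho>(2) ac RN])
  then have ent: "AE x in \<rho>. entropy_density (exp 1) P \<rho> x = ln (D x)"
    by eventually_elim (simp add: entropy_density_def log_def D0)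
  have ent_meas: "entropy_density (exp 1) P \<rho> \<in> borel_measurable \<rho>"
    using \<rho>(2) by (simp cong: measurable_cong_sets)
  have intD: "integrable \<rho> (\<lambda>x. ln (D x))"
    by (rule integrable_cong_AE_imp[OF int(1) _ ent]) measurable
  have KL: "KL_divergence (exp 1) P \<rho> = (\<integral>x. ln (D x) \<partial>\<rho>)"
    unfolding KL_divergence_def by (rule integral_cong_AE[OF ent_meas _ ent]) measurable
  \<comment> \<open>The density of \<open>\<rho>\<close> with respect to \<open>density P h\<close> is \<open>D / h\<close>.\<close>
  have lnDh: "AE x in \<rho>. log (exp 1) (D x / h x) = ln (D x) - ln (h x)"
    using Dpos by eventually_elim (simp add: log_def ln_div h less_imp_neq[OF h, symmetric])
  have intDh: "integrable \<rho> (\<lambda>x. log (exp 1) (D x / h x))"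
    by (subst integrable_cong_AE[OF _ _ lnDh]) (use intD int(2) in simp_all)
  have intQ: "integrable (density P h) (\<lambda>x. D x / h x * log (exp 1) (D x / h x))"
    using intDh unfolding \<rho>Dh
    by (subst (asm) integrable_real_density) (use D0 h in \<open>auto simp: less_imp_le\<close>)
  have "KL_divergence (exp 1) (density P h) \<rho> = (\<integral>x. D x / h x * log (exp 1) (D x / h x) \<partial>density P h)"
    unfolding \<rho>Dh by (rule Q.KL_density) (use D0 h in \<open>auto simp: less_imp_le\<close>)
  also have "\<dots> = (\<integral>x. log (exp 1) (D x / h x) \<partial>\<rho>)"
    unfolding \<rho>Dh by (rule integral_real_density[symmetric]) (use D0 h in \<open>auto simp: less_imp_le\<close>)
  also have "\<dots> = (\<integral>x. ln (D x) - ln (h x) \<partial>\<rho>)"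
    by (rule integral_cong_AE[OF _ _ lnDh]) measurable
  also have "\<dots> = KL_divergence (exp 1) P \<rho> - (\<integral>x. ln (h x) \<partial>\<rho>)"
    using intD int(2) KL by simp
  finally have KLQ: "KL_divergence (exp 1) (density P h) \<rho>
      = KL_divergence (exp 1) P \<rho> - (\<integral>x. ln (h x) \<partial>\<rho>)" .
  have prob: "prob_space (density (density P h) (\<lambda>x. D x / h x))"
    using \<rho>(1) \<rho>Dh by simp
  have nn: "AE x in density P h. 0 \<le> D x / h x"
    using D0 h by (auto simp: less_imp_le)
  have meas: "(\<lambda>x. D x / h x) \<in> borel_measurable (density P h)" by measurable
  have "0 \<le> KL_divergence (exp 1) (density P h) \<rho>"
    using Q.KL_nonneg[OF prob meas nn intQ] \<rho>Dh by simp
  then show "(\<integral>x. ln (h x) \<partial>\<rho>) \<le> KL_divergence (exp 1) P \<rho>"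
    using KLQ by simp
  assume "(\<integral>x. ln (h x) \<partial>\<rho>) = KL_divergence (exp 1) P \<rho>"
  then have "KL_divergence (exp 1) (density P h) \<rho> = 0" using KLQ by simp
  then show "\<rho> = density P h"
    using Q.KL_eq_0_iff_eq[OF prob meas nn intQ] \<rho>Dh by metis
qed

text \<open>The divergence of \<open>density P h\<close> from \<open>P\<close>: the Radon--Nikodym derivative in its definition is
  almost everywhere equal to \<open>h\<close>.\<close>
lemma KL_density_self:
  fixes h :: "'a \<Rightarrow> real"
  assumes "prob_space P" and [measurable]: "h \<in> borel_measurable P" and h: "\<And>x. 0 < h x"
    and int: "integrable (density P h) (\<lambda>x. ln (h x))"
  shows "KL (density P h) P = ereal (\<integral>x. ln (h x) \<partial>density P h)"
proof -
  interpret P: prob_space P by fact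
  have ac: "absolutely_continuous P (density P h)"
    by (rule absolutely_continuousI_density) simp
  have "AE x in P. ennreal (h x) = RN_deriv P (density P h) x"
    by (rule P.RN_deriv_unique) simp_all
  then have "AE x in density P h. ennreal (h x) = RN_deriv P (density P h) x"
    by (rule absolutely_continuous_AE[rotated 2]) (use ac in simp_all)
  then have ent: "AE x in density P h. entropy_density (exp 1) P (density P h) x = ln (h x)"
  proof eventually_elim
    case (elim x)
    then show ?case using h[of x] by (simp add: entropy_density_def log_def elim[symmetric])
  qed
  have "integrable (density P h) (entropy_density (exp 1) P (density P h))"
    by (subst integrable_cong_AE[OF _ _ ent]) (use int in simp_all)
  moreover have "KL_divergence (exp 1) P (density P h) = (\<integral>x. ln (h x) \<partial>density P h)"
    unfolding KL_divergence_def by (rule integral_cong_AE[OF _ _ ent]) simp_all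
  ultimately show ?thesis using ac by (simp add: KL_def)
qed

section \<open>Empirical risk and ridge regression\<close>

lemma emp_risk_nonneg: "0 \<le> emp_risk n X Y f"
  by (simp add: emp_risk_def sum_nonneg)

lemma borel_measurable_emp_risk [measurable]:
  "(\<lambda>\<theta>. emp_risk n X Y (linear_pred \<theta>)) \<in> borel_measurable borel"
  unfolding emp_risk_def linear_pred_def by measurable

lemma avg_risk_eq:
  assumes "integrable \<rho> (\<lambda>\<theta>. emp_risk n X Y (f \<theta>))"
  shows "avg_risk f n X Y \<rho> = ereal (\<integral>\<theta>. emp_risk n X Y (f \<theta>) \<partial>\<rho>)"
  unfolding avg_risk_def using assms
  by (subst nn_integral_eq_integral) (auto simp: emp_risk_nonneg enn2ereal_ennreal integral_nonneg)

lemma integrable_of_square: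
  fixes u :: "'a \<Rightarrow> real"
  assumes "finite_measure M" and [measurable]: "u \<in> borel_measurable M"
    and "integrable M (\<lambda>x. (u x)\<^sup>2)"
  shows "integrable M u"
proof -
  interpret finite_measure M by fact
  show ?thesis
  proof (rule Bochner_Integration.integrable_bound)
    show "integrable M (\<lambda>x. 1 + (u x)\<^sup>2)" using assms(3) by simp
    have "\<bar>u x\<bar> \<le> 1 + (u x)\<^sup>2" for x
      using sum_squares_bound[of 1 "\<bar>u x\<bar>"] abs_ge_zero[of "u x"] by simp
    then show "AE x in M. norm (u x) \<le> norm (1 + (u x)\<^sup>2)" by simp
  qed measurable
qed

text \<open>A finite average risk controls the second moments of the predictions at the data points,
  hence also their means.\<close>
lemma finite_avg_risk:
  fixes \<rho> :: "(real ^ 'd) measure"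
  assumes \<rho>: "\<rho> \<in> prob_measures" and fin: "avg_risk linear_pred n X Y \<rho> \<noteq> \<infinity>"
  shows "integrable \<rho> (\<lambda>\<theta>. emp_risk n X Y (linear_pred \<theta>))"
    and "i \<in> {1..n} \<Longrightarrow> integrable \<rho> (\<lambda>\<theta>. \<theta> \<bullet> X i)"
proof -
  have sets[measurable_cong]: "sets \<rho> = sets borel" and "prob_space \<rho>"
    using \<rho> by (auto simp: space_prob_algebra)
  interpret prob_space \<rho> by fact
  have "(\<integral>\<^sup>+\<theta>. ennreal (emp_risk n X Y (linear_pred \<theta>)) \<partial>\<rho>) \<noteq> \<infinity>"
    using fin by (auto simp: avg_risk_def)
  then show int: "integrable \<rho> (\<lambda>\<theta>. emp_risk n X Y (linear_pred \<theta>))"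
    by (intro integrableI_nonneg) (auto simp: emp_risk_nonneg less_top)
  assume i: "i \<in> {1..n}"
  have "integrable \<rho> (\<lambda>\<theta>. (\<theta> \<bullet> X i - Y i)\<^sup>2)"
  proof (rule Bochner_Integration.integrable_bound)
    show "integrable \<rho> (\<lambda>\<theta>. real n * emp_risk n X Y (linear_pred \<theta>))" using int by simp
    have "(\<theta> \<bullet> X i - Y i)\<^sup>2 \<le> real n * emp_risk n X Y (linear_pred \<theta>)" for \<theta>
    proof -
      have "(\<theta> \<bullet> X i - Y i)\<^sup>2 \<le> (\<Sum>i = 1..n. (\<theta> \<bullet> X i - Y i)\<^sup>2)"
        using i by (intro member_le_sum) auto
      also have "\<dots> = real n * emp_risk n X Y (linear_pred \<theta>)"
        using i by (simp add: emp_risk_def linear_pred_def)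
      finally show ?thesis .
    qed
    then show "AE \<theta> in \<rho>. norm ((\<theta> \<bullet> X i - Y i)\<^sup>2) \<le> norm (real n * emp_risk n X Y (linear_pred \<theta>))"
      by (intro AE_I2) (simp add: emp_risk_nonneg)
  qed measurable
  then have "integrable \<rho> (\<lambda>\<theta>. \<theta> \<bullet> X i - Y i)"
    by (rule integrable_of_square[OF finite_measure_axioms, rotated]) measurable
  then have "integrable \<rho> (\<lambda>\<theta>. (\<theta> \<bullet> X i - Y i) + Y i)" by (rule Bochner_Integration.integrable_add) simp
  then show "integrable \<rho> (\<lambda>\<theta>. \<theta> \<bullet> X i)" by simp
qed

lemma emp_cov_mult: "emp_cov n X *v z = (1 / real n) *\<^sub>R (\<Sum>i = 1..n. (X i \<bullet> z) *\<^sub>R X i)"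
proof -
  have "(emp_cov n X *v z) $ j = ((1 / real n) *\<^sub>R (\<Sum>i = 1..n. (X i \<bullet> z) *\<^sub>R X i)) $ j" for j
  proof -
    have "(emp_cov n X *v z) $ j
        = (\<Sum>k\<in>UNIV. \<Sum>i = 1..n. 1 / real n * (X i $ k * z $ k * X i $ j))"
      by (simp add: matrix_vector_mult_def emp_cov_def sum_distrib_left sum_distrib_right mult_ac)
    also have "\<dots> = (\<Sum>i = 1..n. \<Sum>k\<in>UNIV. 1 / real n * (X i $ k * z $ k * X i $ j))"
      by (rule sum.swap)
    also have "\<dots> = ((1 / real n) *\<^sub>R (\<Sum>i = 1..n. (X i \<bullet> z) *\<^sub>R X i)) $ j"
      by (simp add: inner_vec_def sum_distrib_left sum_distrib_right mult_ac)
    finally show ?thesis .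
  qed
  then show ?thesis by (simp add: vec_eq_iff)
qed

lemma inner_emp_cov:
  "y \<bullet> (emp_cov n X *v z) = (1 / real n) * (\<Sum>i = 1..n. (y \<bullet> X i) * (z \<bullet> X i))"
  unfolding emp_cov_mult by (simp add: inner_sum_right inner_commute mult.commute)

lemma transpose_emp_cov: "transpose (emp_cov n X) = emp_cov n X"
  by (simp add: vec_eq_iff transpose_def emp_cov_def mult.commute)

lemma inner_regularised_cov:
  "y \<bullet> ((a *\<^sub>R emp_cov n X + l *\<^sub>R mat 1) *v z)
    = a * ((1 / real n) * (\<Sum>i = 1..n. (y \<bullet> X i) * (z \<bullet> X i))) + l * (y \<bullet> z)"
  by (simp add: matrix_vector_mult_add_rdistrib scaleR_matrix_vector_assoc[symmetric]
      inner_add_right inner_emp_cov)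

lemma transpose_add: "transpose (A + B) = transpose A + transpose (B :: 'a::plus ^ 'n ^ 'm)"
  by (simp add: vec_eq_iff transpose_def)

lemma pos_def_regularised_cov:
  assumes "0 \<le> a" "0 < l"
  shows "pos_def (a *\<^sub>R emp_cov n X + l *\<^sub>R mat 1)"
  unfolding pos_def_def inner_regularised_cov
  using assms by (auto simp: transpose_add transpose_scalar transpose_emp_cov sum_nonneg add_nonneg_pos)

lemma emp_risk_expand:
  "emp_risk n X Y (linear_pred \<theta>) = emp_risk n X Y (linear_pred t)
    + 2 * ((1 / real n) * (\<Sum>i = 1..n. (t \<bullet> X i - Y i) * ((\<theta> - t) \<bullet> X i)))
    + (1 / real n) * (\<Sum>i = 1..n. ((\<theta> - t) \<bullet> X i)\<^sup>2)"
proof -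
  have "(\<Sum>i = 1..n. (\<theta> \<bullet> X i - Y i)\<^sup>2) = (\<Sum>i = 1..n. (t \<bullet> X i - Y i)\<^sup>2
      + 2 * ((t \<bullet> X i - Y i) * ((\<theta> - t) \<bullet> X i)) + ((\<theta> - t) \<bullet> X i)\<^sup>2)"
    by (intro sum.cong) (simp_all add: power2_eq_square inner_diff_left algebra_simps)
  then show ?thesis
    by (simp add: emp_risk_def linear_pred_def sum.distrib sum_distrib_left[symmetric] add_divide_distrib)
qed

text \<open>The solution of the normal equation minimises the strictly convex penalised risk, so it is
  the unique minimiser and therefore the value selected by \<open>ridge_estimator\<close>.\<close>
lemma ridge_normal_equation:
  assumes "0 < l"
  shows "(1 / real n) * (\<Sum>i = 1..n. (ridge_estimator n X Y l \<bullet> X i - Y i) * (y \<bullet> X i))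
    = - l * (ridge_estimator n X Y l \<bullet> y)"
proof -
  let ?A = "1 *\<^sub>R emp_cov n X + l *\<^sub>R mat 1"
  define t where "t = matrix_inv ?A *v ((1 / real n) *\<^sub>R (\<Sum>i = 1..n. Y i *\<^sub>R X i))"
  have "?A *v t = (1 / real n) *\<^sub>R (\<Sum>i = 1..n. Y i *\<^sub>R X i)"
    using matrix_inv_invertible(1)[OF pos_def_invertible[OF pos_def_regularised_cov[of 1 l n X]]] assms
    by (simp add: t_def matrix_vector_mul_assoc)
  then have t: "y \<bullet> (?A *v t) = (1 / real n) * (\<Sum>i = 1..n. Y i * (y \<bullet> X i))" for y
    by (simp add: inner_sum_right)
  then have normal: "(1 / real n) * (\<Sum>i = 1..n. (t \<bullet> X i - Y i) * (y \<bullet> X i)) = - l * (t \<bullet> y)" for y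
    using t[of y] unfolding inner_regularised_cov
    by (simp add: left_diff_distrib sum_subtractf right_diff_distrib inner_commute[of t y] algebra_simps)
  let ?F = "\<lambda>\<theta>. emp_risk n X Y (linear_pred \<theta>) + l * (norm \<theta>)\<^sup>2"
  have F: "?F \<theta> = ?F t + (1 / real n) * (\<Sum>i = 1..n. ((\<theta> - t) \<bullet> X i)\<^sup>2) + l * (norm (\<theta> - t))\<^sup>2" for \<theta>
  proof -
    show ?thesis
      unfolding emp_risk_expand[of n X Y \<theta> t] normal
      by (simp add: power2_norm_eq_inner inner_diff_left inner_diff_right inner_commute algebra_simps)
  qed
  have less: "?F t < ?F \<theta>" if "\<theta> \<noteq> t" for \<theta>
  proof -
    have "0 < l * (norm (\<theta> - t))\<^sup>2" using that assms by simp
    moreover have "0 \<le> (1 / real n) * (\<Sum>i = 1..n. ((\<theta> - t) \<bullet> X i)\<^sup>2)" by (simp add: sum_nonneg)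
    ultimately show ?thesis unfolding F[of \<theta>] by linarith
  qed
  have "ridge_estimator n X Y l = t"
    unfolding ridge_estimator_def
  proof (rule arg_minI)
    show "\<not> ?F \<theta> < ?F t" for \<theta>
      using less[of \<theta>] by (cases "\<theta> = t") auto
    show "\<theta> = t" if "\<forall>y. True \<longrightarrow> \<not> ?F y < ?F \<theta>" for \<theta>
      using less[of \<theta>] that by blast
  qed simp
  with normal show ?thesis by simp
qed

text \<open>The first-order Taylor polynomial at \<open>t\<close> of the empirical risk, as a function of the
  parameter $\theta$ of the linear predictor.\<close>
definition linearised_risk :: "nat \<Rightarrow> (nat \<Rightarrow> real ^ 'd) \<Rightarrow> (nat \<Rightarrow> real) \<Rightarrow> real ^ 'd \<Rightarrow> real ^ 'd \<Rightarrow> real" where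
  "linearised_risk n X Y t \<theta> =
    (1 / real n) * (\<Sum>i = 1..n. (t \<bullet> X i - Y i)\<^sup>2 + 2 * (t \<bullet> X i - Y i) * (\<theta> \<bullet> X i - t \<bullet> X i))"

text \<open>The empirical risk is quadratic in $\theta$, so the remainder of its linearisation is exactly
  the quadratic form of the empirical covariance.\<close>
lemma emp_risk_linearised:
  "emp_risk n X Y (linear_pred \<theta>)
    = linearised_risk n X Y t \<theta> + (\<theta> - t) \<bullet> (emp_cov n X *v (\<theta> - t))"
  unfolding emp_risk_def linearised_risk_def linear_pred_def inner_emp_cov
    distrib_left[symmetric] sum.distrib[symmetric]
  by (intro arg_cong[where f = "\<lambda>s. 1 / real n * s"] sum.cong)
    (simp_all add: power2_eq_square inner_diff_left algebra_simps)

text \<open>The average of the linearised risk depends only on the averaged predictor, and each square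
  lies above its tangent.\<close>
lemma integral_linearised_risk:
  assumes \<rho>: "\<rho> \<in> prob_measures" and int: "\<And>i. i \<in> {1..n} \<Longrightarrow> integrable \<rho> (\<lambda>\<theta>. \<theta> \<bullet> X i)"
  shows "integrable \<rho> (linearised_risk n X Y t)"
    and "(\<integral>\<theta>. linearised_risk n X Y t \<theta> \<partial>\<rho>) \<le> emp_risk n X Y (avg_predictor linear_pred \<rho>)"
    and "(\<And>i. i \<in> {1..n} \<Longrightarrow> avg_predictor linear_pred \<rho> (X i) = t \<bullet> X i) \<Longrightarrow>
      (\<integral>\<theta>. linearised_risk n X Y t \<theta> \<partial>\<rho>) = emp_risk n X Y (avg_predictor linear_pred \<rho>)"
proof -
  interpret prob_space \<rho> using \<rho> by (simp add: space_prob_algebra)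
  show "integrable \<rho> (linearised_risk n X Y t)"
    unfolding linearised_risk_def[abs_def] using int
    by (intro integrable_mult_right Bochner_Integration.integrable_sum Bochner_Integration.integrable_add
        Bochner_Integration.integrable_diff) auto
  let ?m = "\<lambda>i. avg_predictor linear_pred \<rho> (X i)"
  have eq: "(\<integral>\<theta>. linearised_risk n X Y t \<theta> \<partial>\<rho>)
      = (1 / real n) * (\<Sum>i = 1..n. (t \<bullet> X i - Y i)\<^sup>2 + 2 * (t \<bullet> X i - Y i) * (?m i - t \<bullet> X i))"
  proof -
    have "(\<integral>\<theta>. linearised_risk n X Y t \<theta> \<partial>\<rho>) = (1 / real n) *
      (\<Sum>i = 1..n. \<integral>\<theta>. (t \<bullet> X i - Y i)\<^sup>2 + 2 * (t \<bullet> X i - Y i) * (\<theta> \<bullet> X i - t \<bullet> X i) \<partial>\<rho>)"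
      unfolding linearised_risk_def using int
      by (subst Bochner_Integration.integral_mult_right_zero, subst Bochner_Integration.integral_sum) auto
    also have "\<dots> = (1 / real n) * (\<Sum>i = 1..n. (t \<bullet> X i - Y i)\<^sup>2 + 2 * (t \<bullet> X i - Y i) * (?m i - t \<bullet> X i))"
      using int by (intro arg_cong[where f = "\<lambda>s. 1 / real n * s"] sum.cong)
        (simp_all add: prob_space avg_predictor_def linear_pred_def)
    finally show ?thesis .
  qed
  have "(t \<bullet> X i - Y i)\<^sup>2 + 2 * (t \<bullet> X i - Y i) * (?m i - t \<bullet> X i) \<le> (?m i - Y i)\<^sup>2" for i
  proof -
    have "(?m i - Y i)\<^sup>2 = (t \<bullet> X i - Y i)\<^sup>2 + 2 * (t \<bullet> X i - Y i) * (?m i - t \<bullet> X i) + (?m i - t \<bullet> X i)\<^sup>2"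
      by (simp add: power2_eq_square algebra_simps)
    then show ?thesis by simp
  qed
  then show "(\<integral>\<theta>. linearised_risk n X Y t \<theta> \<partial>\<rho>) \<le> emp_risk n X Y (avg_predictor linear_pred \<rho>)"
    unfolding eq emp_risk_def by (intro mult_left_mono sum_mono) auto
  assume "\<And>i. i \<in> {1..n} \<Longrightarrow> ?m i = t \<bullet> X i"
  then show "(\<integral>\<theta>. linearised_risk n X Y t \<theta> \<partial>\<rho>) = emp_risk n X Y (avg_predictor linear_pred \<rho>)"
    unfolding eq emp_risk_def by (intro arg_cong[where f = "\<lambda>s. 1 / real n * s"] sum.cong) auto
qed

lemma linearised_risk_ridge:
  fixes X :: "nat \<Rightarrow> real ^ 'd" and n Y and l :: real
  assumes "0 < l"
  defines "t \<equiv> ridge_estimator n X Y l"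
  shows "linearised_risk n X Y t \<theta> + l * (norm \<theta>)\<^sup>2
    = emp_risk n X Y (linear_pred t) + l * (norm t)\<^sup>2 + l * (norm (\<theta> - t))\<^sup>2"
proof -
  have "linearised_risk n X Y t \<theta> = emp_risk n X Y (linear_pred t)
      + 2 * ((1 / real n) * (\<Sum>i = 1..n. (t \<bullet> X i - Y i) * ((\<theta> - t) \<bullet> X i)))"
    unfolding linearised_risk_def emp_risk_def linear_pred_def mult.assoc
    by (simp add: sum.distrib sum_distrib_left[symmetric] add_divide_distrib inner_diff_left)
  also have "(1 / real n) * (\<Sum>i = 1..n. (t \<bullet> X i - Y i) * ((\<theta> - t) \<bullet> X i)) = - l * (t \<bullet> (\<theta> - t))"
    unfolding t_def by (rule ridge_normal_equation[OF assms(1)])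
  finally show ?thesis
    by (simp add: power2_norm_eq_inner inner_diff_left inner_diff_right inner_commute algebra_simps)
qed

section \<open>The posteriors\<close>

text \<open>Both posteriors at once, as minimisers of the interpolated objective \<open>J\<close>. The condition
  \<open>a < 1\<close> ensures that \<open>J\<close> is infinite whenever the average risk is.\<close>
lemma interpolated_posterior:
  fixes X :: "nat \<Rightarrow> real ^ 'd" and Y :: "nat \<Rightarrow> real" and n :: nat and a \<beta> \<gamma> l :: real
  assumes "0 \<le> a" "a < 1" "\<gamma> > 0" "\<beta> > 0" "l = \<gamma> / \<beta>"
  defines "B \<equiv> \<beta> *\<^sub>R ((1 - a) *\<^sub>R emp_cov n X + l *\<^sub>R mat 1)"
    and "t \<equiv> ridge_estimator n X Y l"
    and "J \<equiv> \<lambda>\<rho>. ereal (1 - a) * avg_risk linear_pred n X Y \<rho>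
      + ereal a * ereal (emp_risk n X Y (avg_predictor linear_pred \<rho>))
      + ereal (2 / \<beta>) * KL \<rho> (gaussian 0 (matrix_inv (\<gamma> *\<^sub>R mat 1)))"
  shows "{\<rho>. is_arg_min J (\<lambda>\<rho>. \<rho> \<in> prob_measures) \<rho>} = {gaussian t (matrix_inv B)}"
proof -
  have l: "l > 0" and \<beta>l: "\<beta> * l = \<gamma>" using assms(3-5) by auto
  define B0 :: "real ^ 'd ^ 'd" where "B0 = \<gamma> *\<^sub>R mat 1"
  have pd: "pos_def B"
    unfolding B_def using assms l by (intro pos_def_scaleR pos_def_regularised_cov) auto
  have pd0: "pos_def B0"
    unfolding B0_def using assms(3) by (auto simp: pos_def_def transpose_scalar transpose_mat scaleR_matrix_vector_assoc[symmetric])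
  define P where "P = density lborel (\<lambda>x. ennreal (gaussian_density 0 B0 x))"
  define G where "G = density lborel (\<lambda>x. ennreal (gaussian_density t B x))"
  have PG: "gaussian 0 (matrix_inv B0) = P" "gaussian t (matrix_inv B) = G"
    unfolding P_def G_def using pd pd0 by (simp_all add: gaussian_matrix_inv)
  have P: "prob_space P" and G: "prob_space G" and sets: "sets P = sets borel" "sets G = sets borel"
    unfolding P_def G_def using pd pd0 by (simp_all add: prob_space_gaussian_density)
  have GP: "G \<in> prob_measures" using G sets by (simp add: space_prob_algebra)
  define h where "h x = gaussian_density t B x / gaussian_density 0 B0 x" for x
  have h: "0 < h x" for x using pd pd0 by (simp add: h_def gaussian_density_pos)
  have h_meas[measurable]: "h \<in> borel_measurable P"
    unfolding h_def[abs_def] P_def by measurable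
  have Gh: "density P h = G"
    unfolding P_def G_def h_def[abs_def]
    using gaussian_density_pos[OF pd] gaussian_density_pos[OF pd0]
    by (intro density_density_divide) (auto simp: less_imp_le less_imp_neq[symmetric])
  define V where "V \<theta> = (1 - a) * emp_risk n X Y (linear_pred \<theta>) + a * linearised_risk n X Y t \<theta>" for \<theta>
  define K K0 where "K = sqrt (det B / (2 * pi) ^ CARD('d))" and "K0 = sqrt (det B0 / (2 * pi) ^ CARD('d))"
  have Kpos: "K > 0" "K0 > 0"
    unfolding K_def K0_def using nn_integral_gaussian_kernel(1)[OF pd] nn_integral_gaussian_kernel(1)[OF pd0] by simp_all
  define k where "k = ln K - ln K0 + \<beta> / 2 * (emp_risk n X Y (linear_pred t) + l * (norm t)\<^sup>2)"
  \<comment> \<open>Up to an additive constant, the log-density of \<open>G\<close> with respect to the prior is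
    \<open>- \<beta> V / 2\<close>.\<close>
  have lnh: "ln (h \<theta>) = k - \<beta> / 2 * V \<theta>" for \<theta>
  proof -
    define q where "q = (\<theta> - t) \<bullet> (emp_cov n X *v (\<theta> - t))"
    define N where "N = (norm (\<theta> - t))\<^sup>2"
    have "ln (h \<theta>) = ln K - ln K0 - (\<theta> - t) \<bullet> (B *v (\<theta> - t)) / 2 + \<theta> \<bullet> (B0 *v \<theta>) / 2"
      unfolding h_def gaussian_density_def K_def[symmetric] K0_def[symmetric]
      using Kpos by (simp add: ln_div ln_mult)
    also have "(\<theta> - t) \<bullet> (B *v (\<theta> - t)) = \<beta> * ((1 - a) * q + l * N)"
      by (simp add: B_def scaleR_matrix_vector_assoc[symmetric] matrix_vector_mult_add_rdistrib
          inner_add_right power2_norm_eq_inner q_def N_def)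
    also have "\<theta> \<bullet> (B0 *v \<theta>) = \<beta> * (l * (norm \<theta>)\<^sup>2)"
      by (simp add: B0_def \<beta>l[symmetric] scaleR_matrix_vector_assoc[symmetric] power2_norm_eq_inner)
    finally have ln: "ln (h \<theta>) = ln K - ln K0 - \<beta> * ((1 - a) * q + l * N) / 2 + \<beta> * (l * (norm \<theta>)\<^sup>2) / 2" .
    have "V \<theta> = linearised_risk n X Y t \<theta> + (1 - a) * q"
      unfolding V_def emp_risk_linearised[of n X Y \<theta> t] q_def[symmetric] by (simp add: algebra_simps)
    then have V: "V \<theta> = emp_risk n X Y (linear_pred t) + l * (norm t)\<^sup>2 + l * N - l * (norm \<theta>)\<^sup>2 + (1 - a) * q"
      using linearised_risk_ridge[OF l, of n X Y \<theta>] unfolding t_def N_def by linarith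
    show ?thesis
      unfolding ln V k_def by (simp add: field_simps)
  qed
  have fin: "J \<rho> = ereal ((1 - a) * (\<integral>\<theta>. emp_risk n X Y (linear_pred \<theta>) \<partial>\<rho>)
        + a * emp_risk n X Y (avg_predictor linear_pred \<rho>) + 2 / \<beta> * kl)"
    if "integrable \<rho> (\<lambda>\<theta>. emp_risk n X Y (linear_pred \<theta>))" "KL \<rho> P = ereal kl" for \<rho> kl
    using that unfolding J_def B0_def[symmetric] PG by (simp add: avg_risk_eq)
  have intV: "integrable \<rho> V" "(\<integral>\<theta>. V \<theta> \<partial>\<rho>) = (1 - a) * (\<integral>\<theta>. emp_risk n X Y (linear_pred \<theta>) \<partial>\<rho>)
      + a * (\<integral>\<theta>. linearised_risk n X Y t \<theta> \<partial>\<rho>)"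
    if "integrable \<rho> (\<lambda>\<theta>. emp_risk n X Y (linear_pred \<theta>))" "integrable \<rho> (linearised_risk n X Y t)" for \<rho>
    using that unfolding V_def[abs_def] by simp_all
  have int_lnh: "integrable \<rho> (\<lambda>\<theta>. ln (h \<theta>))" "(\<integral>\<theta>. ln (h \<theta>) \<partial>\<rho>) = k - \<beta> / 2 * (\<integral>\<theta>. V \<theta> \<partial>\<rho>)"
    if "integrable \<rho> V" "prob_space \<rho>" for \<rho>
  proof -
    interpret prob_space \<rho> by fact
    show "integrable \<rho> (\<lambda>\<theta>. ln (h \<theta>))" "(\<integral>\<theta>. ln (h \<theta>) \<partial>\<rho>) = k - \<beta> / 2 * (\<integral>\<theta>. V \<theta> \<partial>\<rho>)"
      unfolding lnh using that(1) by (simp_all add: prob_space)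
  qed
  have meanG: "integrable G (\<lambda>\<theta>. \<theta> \<bullet> x)" "(\<integral>\<theta>. \<theta> \<bullet> x \<partial>G) = t \<bullet> x" for x
    using gaussian_mean[OF pd, where m = t and a = x, folded G_def] by (simp_all add: inner_commute)
  \<comment> \<open>The lower bound \<open>2 k / \<beta>\<close> is attained at \<open>G\<close>.\<close>
  have JG: "J G = ereal (2 / \<beta> * k)"
  proof -
    interpret G: prob_space G by fact
    have [measurable_cong]: "sets G = sets borel" by fact
    have "integrable G (\<lambda>\<theta>. (\<theta> - t) \<bullet> (emp_cov n X *v (\<theta> - t)))"
    proof -
      have "integrable G (\<lambda>\<theta>. ((\<theta> - t) \<bullet> X i)\<^sup>2)" for i
      proof (rule Bochner_Integration.integrable_bound)
        show "integrable G (\<lambda>\<theta>. (norm (\<theta> - t))\<^sup>2 * (norm (X i))\<^sup>2)"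
          using integrable_gaussian_norm_square[OF pd, of t] by (simp add: G_def)
        show "AE \<theta> in G. norm (((\<theta> - t) \<bullet> X i)\<^sup>2) \<le> norm ((norm (\<theta> - t))\<^sup>2 * (norm (X i))\<^sup>2)"
          using Cauchy_Schwarz_ineq[of _ "X i"] by (intro AE_I2) (simp add: power2_norm_eq_inner)
      qed measurable
      then show ?thesis
        unfolding inner_emp_cov by (simp add: power2_eq_square)
    qed
    moreover have lin: "integrable G (linearised_risk n X Y t)"
      by (rule integral_linearised_risk(1)[OF GP meanG(1)])
    ultimately have risk: "integrable G (\<lambda>\<theta>. emp_risk n X Y (linear_pred \<theta>))"
      unfolding emp_risk_linearised[of n X Y _ t] by simp
    note V = intV[OF risk lin]
    note lnh = int_lnh[OF V(1) G]
    have KLG: "KL G P = ereal (k - \<beta> / 2 * (\<integral>\<theta>. V \<theta> \<partial>G))"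
      using KL_density_self[OF P h_meas h] lnh unfolding Gh by simp
    have tight: "(\<integral>\<theta>. linearised_risk n X Y t \<theta> \<partial>G) = emp_risk n X Y (avg_predictor linear_pred G)"
      by (rule integral_linearised_risk(3)[OF GP meanG(1)]) (simp add: avg_predictor_def linear_pred_def meanG(2))
    show ?thesis
      unfolding fin[OF risk KLG] V(2) tight using assms(4) by (simp add: field_simps)
  qed
  \<comment> \<open>No other measure reaches the bound: such a measure has finite risk and divergence, and
    then both inequalities of the argument apply.\<close>
  have uniq: "\<rho> = G" if \<rho>: "\<rho> \<in> prob_measures" and le: "J \<rho> \<le> ereal (2 / \<beta> * k)" for \<rho>
  proof -
    have prob: "prob_space \<rho>" and s: "sets \<rho> = sets P"
      using \<rho> sets by (auto simp: space_prob_algebra)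
    have KLcases: "KL \<rho> P = \<infinity> \<or> (\<exists>kl. KL \<rho> P = ereal kl)" by (auto simp: KL_def)
    have avg_nonneg: "0 \<le> avg_risk linear_pred n X Y \<rho>" by (simp add: avg_risk_def)
    have avg: "avg_risk linear_pred n X Y \<rho> \<noteq> \<infinity>"
    proof
      assume "avg_risk linear_pred n X Y \<rho> = \<infinity>"
      then have "J \<rho> = \<infinity>"
        using KLcases assms(2,4) unfolding J_def B0_def[symmetric] PG by auto
      with le show False by simp
    qed
    have "KL \<rho> P \<noteq> \<infinity>"
    proof
      assume "KL \<rho> P = \<infinity>"
      then have "J \<rho> = \<infinity>"
        using avg avg_nonneg assms(2,4) unfolding J_def B0_def[symmetric] PG
        by (cases "avg_risk linear_pred n X Y \<rho>") auto
      with le show False by simp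
    qed
    then have ac: "absolutely_continuous P \<rho>" and ent: "integrable \<rho> (entropy_density (exp 1) P \<rho>)"
      and KL: "KL \<rho> P = ereal (KL_divergence (exp 1) P \<rho>)"
      by (auto simp: KL_def split: if_splits)
    note risk = finite_avg_risk(1)[OF \<rho> avg]
    note lin = integral_linearised_risk(1,2)[OF \<rho> finite_avg_risk(2)[OF \<rho> avg], where Y = Y and t = t]
    note V = intV[OF risk lin(1)]
    note lnh = int_lnh[OF V(1) prob]
    have "(1 - a) * (\<integral>\<theta>. emp_risk n X Y (linear_pred \<theta>) \<partial>\<rho>)
        + a * emp_risk n X Y (avg_predictor linear_pred \<rho>) + 2 / \<beta> * KL_divergence (exp 1) P \<rho> \<le> 2 / \<beta> * k"
      using le fin[OF risk KL] by simp
    moreover have "a * (\<integral>\<theta>. linearised_risk n X Y t \<theta> \<partial>\<rho>) \<le> a * emp_risk n X Y (avg_predictor linear_pred \<rho>)"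
      using lin(2) assms(1) by (rule mult_left_mono)
    ultimately have "2 / \<beta> * KL_divergence (exp 1) P \<rho> \<le> 2 / \<beta> * k - (\<integral>\<theta>. V \<theta> \<partial>\<rho>)"
      using V(2) by linarith
    then have "KL_divergence (exp 1) P \<rho> \<le> k - \<beta> / 2 * (\<integral>\<theta>. V \<theta> \<partial>\<rho>)"
      using assms(4) by (simp add: field_simps)
    then have "KL_divergence (exp 1) P \<rho> \<le> (\<integral>\<theta>. ln (h \<theta>) \<partial>\<rho>)"
      using lnh(2) by linarith
    then show "\<rho> = G"
      using Gibbs_variational_principle[OF P h_meas h, unfolded Gh, OF G prob s ac ent lnh(1)] by auto
  qed
  have "{\<rho>. is_arg_min J (\<lambda>\<rho>. \<rho> \<in> prob_measures) \<rho>} = {G}"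
  proof (intro equalityI subsetI)
    fix \<rho> assume "\<rho> \<in> {\<rho>. is_arg_min J (\<lambda>\<rho>. \<rho> \<in> prob_measures) \<rho>}"
    then have "\<rho> \<in> prob_measures" "J \<rho> \<le> J G" using GP by (auto simp: is_arg_min_linorder)
    then show "\<rho> \<in> {G}" using uniq JG by simp
  next
    have "J G \<le> J \<rho>" if "\<rho> \<in> prob_measures" for \<rho>
    proof (rule ccontr)
      assume less: "\<not> J G \<le> J \<rho>"
      then have "\<rho> = G" using uniq[OF that] by (simp add: JG)
      with less show False by simp
    qed
    moreover fix \<rho> assume "\<rho> \<in> {G}"
    ultimately show "\<rho> \<in> {\<rho>. is_arg_min J (\<lambda>\<rho>. \<rho> \<in> prob_measures) \<rho>}"
      using GP by (simp add: is_arg_min_linorder)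
  qed
  then show ?thesis by (simp add: PG)
qed

theorem proposition2:
  fixes n :: nat
    and X :: "nat \<Rightarrow> real ^ 'd" and Y :: "nat \<Rightarrow> real"
    and \<gamma> \<beta> l :: real
    and \<pi> \<rho>Q \<rho>E :: "(real ^ 'd) measure"
  assumes "n \<ge> 1" and "\<gamma> > 0" and "\<beta> > 0" and "l = \<gamma> / \<beta>"
    and "\<pi> = gaussian 0 ((1 / \<gamma>) *\<^sub>R mat 1)"
    and "\<rho>Q = gaussian (ridge_estimator n X Y l)
           ((1 / \<beta>) *\<^sub>R matrix_inv ((1 / 2) *\<^sub>R emp_cov n X + l *\<^sub>R mat 1))"
    and "\<rho>E = gaussian (ridge_estimator n X Y l)
           ((1 / \<beta>) *\<^sub>R matrix_inv (emp_cov n X + l *\<^sub>R mat 1))"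
  shows "Q_aggregation_posteriors linear_pred n X Y \<pi> (\<beta> / 2) = {\<rho>Q}
    \<and> exp_weights_posteriors linear_pred n X Y \<pi> (\<beta> / 2) = {\<rho>E}
    \<and> (\<forall>\<rho> \<in> {\<rho>Q, \<rho>E}. (\<forall>x. integrable \<rho> (\<lambda>\<theta>. linear_pred \<theta> x))
         \<and> avg_predictor linear_pred \<rho> = linear_pred (ridge_estimator n X Y l))"
proof -
  have l: "l > 0" using assms(2-4) by simp
  have "matrix_inv (mat 1 :: real ^ 'd ^ 'd) = mat 1"
    by (rule matrix_inv_unique) simp
  then have \<pi>: "\<pi> = gaussian 0 (matrix_inv (\<gamma> *\<^sub>R mat 1))"
    using assms(2) scaled_matrix_inv[of "mat 1 :: real ^ 'd ^ 'd" \<gamma>]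
    by (simp add: assms(5) invertible_def exI[of _ "mat 1 :: real ^ 'd ^ 'd"])
  \<comment> \<open>The weight of the empirical covariance is \<open>1/2\<close> for \<open>\<rho>Q\<close> and \<open>1\<close> for \<open>\<rho>E\<close>.\<close>
  let ?A = "\<lambda>a. a *\<^sub>R emp_cov n X + l *\<^sub>R mat 1"
  have pd: "pos_def (\<beta> *\<^sub>R ?A a)" if "0 \<le> a" for a
    using that l assms(3) by (intro pos_def_scaleR pos_def_regularised_cov)
  have inv: "(1 / \<beta>) *\<^sub>R matrix_inv (?A a) = matrix_inv (\<beta> *\<^sub>R ?A a)" if "0 \<le> a" for a
    using that l assms(3) by (intro scaled_matrix_inv pos_def_invertible pos_def_regularised_cov) auto
  have \<rho>Q: "\<rho>Q = gaussian (ridge_estimator n X Y l) (matrix_inv (\<beta> *\<^sub>R ?A (1 / 2)))"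
    unfolding assms(6) using inv[of "1 / 2"] by simp
  have \<rho>E: "\<rho>E = gaussian (ridge_estimator n X Y l) (matrix_inv (\<beta> *\<^sub>R ?A 1))"
    unfolding assms(7) using inv[of 1] by simp
  have "Q_aggregation_posteriors linear_pred n X Y \<pi> (\<beta> / 2) = {\<rho>Q}"
    using interpolated_posterior[of "1 / 2" \<gamma> \<beta> l n X Y] assms(2-4)
    unfolding Q_aggregation_posteriors_def \<rho>Q \<pi> by simp
  moreover have "exp_weights_posteriors linear_pred n X Y \<pi> (\<beta> / 2) = {\<rho>E}"
    using interpolated_posterior[of 0 \<gamma> \<beta> l n X Y] assms(2-4)
    unfolding exp_weights_posteriors_def \<rho>E \<pi>
    by (simp add: zero_ereal_def[symmetric] one_ereal_def[symmetric])
  ultimately show ?thesis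
    unfolding \<rho>Q \<rho>E
    using gaussian_predictor[OF pd[of "1 / 2"]] gaussian_predictor[OF pd[of 1]] by simp
qed

end
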